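(* Let $m \ge 3$ be odd and $n = 3^m-1$. Then the dual code $\mathcal{C}_{(1,2,m)}^\perp$ has parameters $[n,k,d]$ with $d \ge \frac{3^{(m-1)/2}+9}{2}$ if $m \equiv 3 \pmod 4$ and $d \ge \frac{3^{(m-1)/2}+7}{2}$ if $m \equiv 1 \pmod 4$, and $k = \frac{n-2}{2}$ if $m \equiv 3 \pmod 4$ and $k = \frac{n}{2}$ if $m \equiv 1 \pmod 4$.
   Context: Let $m \ge 2$ be an integer, $n = 3^m-1$, and let $\alpha$ be a primitive element of $\mathbb{F}_{3^m}$. For an integer $0 \le j \le n-1$ with $3$-adic expansion $j = \sum_{t=0}^{m-1} j_t 3^t$, $j_t \in \{0,1,2\}$, let $w_3(j) = \sum_{t=0}^{m-1} j_t$. For distinct $i_1, i_2 \in \{0,1,2,3\}$ let $T_{(i_1,i_2,m)} = \{1 \le j \le n-1 : w_3(j) \equiv i_1 \text{ or } i_2 \pmod 4\}$ and $g_{(i_1,i_2,m)}(x) = \prod_{j \in T_{(i_1,i_2,m)}} (x - \alpha^j) \in \mathbb{F}_3[x]$. $\mathcal{C}_{(i_1,i_2,m)}$ denotes the ternary cyclic code of length $n$ with generator polynomial $g_{(i_1,i_2,m)}(x)$, and $\mathcal{C}^\perp$ denotes the dual code with respect to the standard inner product on $\mathbb{F}_3^n$. Parameters $[n,k,d]$ mean length, dimension over $\mathbb{F}_3$, and minimum Hamming distance. *)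

theory Defs
  imports "HOL-Computational_Algebra.Polynomial" "HOL-Library.Cardinality"
begin

definition w3 :: "nat \<Rightarrow> nat \<Rightarrow> nat" where
  "w3 m j = (\<Sum>t<m. (j div 3 ^ t) mod 3)"

definition T_set :: "nat \<Rightarrow> nat \<Rightarrow> nat \<Rightarrow> nat set" where
  "T_set i1 i2 m = {j. 1 \<le> j \<and> j \<le> 3 ^ m - 2 \<and>
      (w3 m j mod 4 = i1 \<or> w3 m j mod 4 = i2)}"

definition gen_poly :: "'a::field \<Rightarrow> nat \<Rightarrow> nat \<Rightarrow> nat \<Rightarrow> 'a poly" where
  "gen_poly \<alpha> i1 i2 m = (\<Prod>j\<in>T_set i1 i2 m. [:- (\<alpha> ^ j), 1:])"

text \<open>The prime subfield F_3 inside a field of characteristic 3.\<close>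
definition F3 :: "'a::field set" where
  "F3 = range of_nat"

definition vecs :: "nat \<Rightarrow> (nat \<Rightarrow> 'a::field) set" where
  "vecs n = {c. (\<forall>i<n. c i \<in> F3) \<and> (\<forall>i\<ge>n. c i = 0)}"

definition poly_of_vec :: "nat \<Rightarrow> (nat \<Rightarrow> 'a::field) \<Rightarrow> 'a poly" where
  "poly_of_vec n c = (\<Sum>i<n. monom (c i) i)"

definition cyclic_code :: "nat \<Rightarrow> 'a::field poly \<Rightarrow> (nat \<Rightarrow> 'a) set" where
  "cyclic_code n g = {c \<in> vecs n. \<exists>a. (\<forall>i. coeff a i \<in> F3) \<and>
      poly_of_vec n c = (a * g) mod (monom 1 n - 1)}"

definition dual_code :: "nat \<Rightarrow> (nat \<Rightarrow> 'a::field) set \<Rightarrow> (nat \<Rightarrow> 'a) set" where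
  "dual_code n C = {d \<in> vecs n. \<forall>c\<in>C. (\<Sum>i<n. c i * d i) = 0}"

definition hweight :: "nat \<Rightarrow> (nat \<Rightarrow> 'a::zero) \<Rightarrow> nat" where
  "hweight n c = card {i. i < n \<and> c i \<noteq> 0}"

definition min_dist :: "nat \<Rightarrow> (nat \<Rightarrow> 'a::zero) set \<Rightarrow> nat" where
  "min_dist n C = Min (hweight n ` (C - {\<lambda>_. 0}))"

text \<open>A linear code over F_3 has dimension k iff it has 3^k elements.\<close>
definition dim3 :: "(nat \<Rightarrow> 'a) set \<Rightarrow> nat \<Rightarrow> bool" where
  "dim3 C k \<longleftrightarrow> card C = 3 ^ k"

end

theory Submission
  imports Defs "HOL-Number_Theory.Cong" "HOL-Library.FuncSet"
begin

text \<open>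
  Parseval's identity and codewords of trace form show that the dual code consists of the vectors
  whose discrete Fourier transform vanishes at 0 and at all exponents of weight 2 or 3 modulo 4.
  Let m = 2h + 1 and N = n / 2, and fold a codeword c to its even part c(i) + c(i + N) and its odd
  part c(i) - c(i + N), which carry the transform at even and at odd exponents. Let r be the odd
  one among h and h + 1.

  The multiples i (3^r - 1) with 1 \<le> i \<le> 3^h have weight 2r, which is 2 modulo 4. Together with
  the exponent 0 they form a progression of 3^h + 1 zeros, and \<alpha>^(3^r - 1) has order N, so the BCH
  bound gives weight at least 3^h + 2 for a nonzero even part. The even part is self-orthogonal, so
  its weight is divisible by 3 and hence at least 3^h + 3. If the even part vanishes, the weight of c
  is twice that of the odd part, for which the exponents 3^(2h) + i (3^r - 1) with
  1 \<le> i \<le> 3^(2h - r) have weight 2r + 1, which is 3 modulo 4.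
\<close>

section \<open>Ternary digit sums\<close>

lemma w3_0 [simp]: "w3 0 j = 0" and w3_zero [simp]: "w3 m 0 = 0"
  by (simp_all add: w3_def)

lemma w3_Suc: "w3 (Suc m) j = j mod 3 + w3 m (j div 3)"
  by (simp add: w3_def sum.lessThan_Suc_shift div_mult2_eq del: sum.lessThan_Suc)

lemma w3_concat:
  assumes "b < 3 ^ r"
  shows "w3 (r + k) (a * 3 ^ r + b) = w3 r b + w3 k a"
  using assms
proof (induction r arbitrary: b)
  case (Suc r)
  have "(a * 3 ^ Suc r + b) mod 3 = b mod 3"
    by (simp add: mod_add_left_eq [symmetric] mult.assoc)
  moreover have "(a * 3 ^ Suc r + b) div 3 = a * 3 ^ r + b div 3"
    by (simp add: mult.left_commute)
  moreover have "b div 3 < 3 ^ r"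
    using Suc.prems by (simp add: less_mult_imp_div_less mult.commute)
  ultimately show ?case
    using Suc.IH [of "b div 3"] by (simp add: w3_Suc)
qed simp

lemma w3_extend: "b < 3 ^ r \<Longrightarrow> r \<le> k \<Longrightarrow> w3 k b = w3 r b"
  using w3_concat [of b r "k - r" 0] by simp

text \<open>Subtracting from \<open>3 ^ r - 1\<close>, all of whose digits are 2, needs no borrow:
  every digit d turns into 2 - d.\<close>

lemma w3_complement: "b < 3 ^ r \<Longrightarrow> w3 r (3 ^ r - 1 - b) + w3 r b = 2 * r"
proof (induction r arbitrary: b)
  case (Suc r)
  define q where "q = b div 3"
  have q: "q < 3 ^ r"
    using Suc.prems by (simp add: q_def less_mult_imp_div_less mult.commute)
  have "3 ^ Suc r - 1 - b = 3 * (3 ^ r - 1 - q) + (2 - b mod 3)"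
    using q mult_div_mod_eq [of 3 b] by (simp add: q_def algebra_simps)
  moreover have "(3 * k + d) mod 3 = d" "(3 * k + d) div 3 = k" if "d < 3" for k d :: nat
    using that by simp_all
  moreover have "2 - b mod 3 < 3" by simp
  ultimately have "(3 ^ Suc r - 1 - b) mod 3 = 2 - b mod 3"
    and "(3 ^ Suc r - 1 - b) div 3 = 3 ^ r - 1 - q"
    by presburger+
  moreover have "b mod 3 \<le> 2" by simp
  ultimately show ?case
    using Suc.IH [OF q] by (simp add: w3_Suc q_def)
qed simp

text \<open>Since i (3^r - 1) = (i - 1) 3^r + (3^r - 1 - (i - 1)), the digits of i - 1 stand above
  their own complements, and the two blocks together weigh 2r whatever i is. The bound
  \<open>k \<le> r\<close> makes i - 1 fit into the lower block.\<close>

lemma w3_mult_pow3_minus_1: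
  assumes "1 \<le> i" "i \<le> 3 ^ k" "k \<le> r" "r + k \<le> l"
  shows "w3 l (i * (3 ^ r - 1)) = 2 * r" and "i * (3 ^ r - 1) < 3 ^ (r + k)"
proof -
  have i: "i - 1 < 3 ^ k" using assms by linarith
  have "(3::nat) ^ k \<le> 3 ^ r" using assms by simp
  with i have ir: "i - 1 < 3 ^ r" by linarith
  have eq: "i * (3 ^ r - 1) = (i - 1) * 3 ^ r + (3 ^ r - 1 - (i - 1))"
  proof -
    obtain p where "i = Suc p" using assms by (cases i) auto
    then show ?thesis using ir by (simp add: algebra_simps)
  qed
  have "i * (3 ^ r - 1) < i * 3 ^ r" using assms by simp
  also have "\<dots> \<le> 3 ^ k * 3 ^ r" using assms by simp
  finally show less: "i * (3 ^ r - 1) < 3 ^ (r + k)"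
    by (simp add: power_add mult.commute)
  have "w3 l (i * (3 ^ r - 1)) = w3 (r + k) (i * (3 ^ r - 1))"
    by (rule w3_extend [OF less assms(4)])
  also have "\<dots> = w3 r (3 ^ r - 1 - (i - 1)) + w3 k (i - 1)"
    unfolding eq by (rule w3_concat) simp
  also have "w3 k (i - 1) = w3 r (i - 1)"
    by (rule w3_extend [OF i assms(3), symmetric])
  also have "w3 r (3 ^ r - 1 - (i - 1)) + w3 r (i - 1) = 2 * r"
    by (rule w3_complement [OF ir])
  finally show "w3 l (i * (3 ^ r - 1)) = 2 * r" .
qed

lemma w3_add_leading_one:
  assumes "b < 3 ^ l" shows "w3 (Suc l) (3 ^ l + b) = w3 l b + 1"
  using w3_concat [OF assms, of 1 1] by (simp add: w3_Suc)

text \<open>Modulo \<open>3 ^ m - 1\<close>, multiplication by 3 moves the leading digit to the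
  lowest place, because 3^m is congruent to 1.\<close>

lemma w3_rotate:
  assumes "j < 3 ^ m - 1"
  shows "w3 m (3 * j mod (3 ^ m - 1)) = w3 m j"
proof (cases m)
  case (Suc l)
  define a b where "a = j div 3 ^ l" and "b = j mod 3 ^ l"
  have j: "j = a * 3 ^ l + b" and b: "b < 3 ^ l"
    by (simp_all only: a_def b_def div_mult_mod_eq) simp
  have a: "a < 3"
    using assms Suc by (simp add: a_def less_mult_imp_div_less)
  \<comment> \<open>The rotated number is already reduced: equality would make all digits 2, which
    is the excluded j = 3^m - 1.\<close>
  have "3 * b + a < 3 ^ m - 1"
  proof (rule ccontr)
    assume "\<not> ?thesis"
    then have "a = 2" "b = 3 ^ l - 1" using a b Suc by auto
    with j assms Suc show False by simp
  qed
  moreover have "3 * j = (3 * b + a) + a * (3 ^ m - 1)"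
    using Suc j by (simp add: diff_mult_distrib2)
  ultimately have "3 * j mod (3 ^ m - 1) = 3 * b + a"
    by simp
  then have "w3 m (3 * j mod (3 ^ m - 1)) = a + w3 l b"
    using a Suc by (simp add: w3_Suc)
  also have "\<dots> = w3 m j"
    using w3_concat [OF b, of 1 a] a Suc by (simp add: j w3_Suc)
  finally show ?thesis .
qed simp

section \<open>Counting exponents by digit sum modulo 4\<close>

definition w3_count :: "nat \<Rightarrow> nat \<Rightarrow> nat" where
  "w3_count m k = card {j. j < 3 ^ m \<and> (w3 m j + k) mod 4 \<in> {1, 2}}"

text \<open>The offset 2 exchanges the residues {1, 2} with {3, 0}, so the two sets partition the
  numbers below \<open>3 ^ m\<close>.\<close>

lemma w3_count_complement: "w3_count m k + w3_count m (k + 2) = 3 ^ m"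
proof -
  let ?A = "\<lambda>k. {j. j < 3 ^ m \<and> (w3 m j + k) mod 4 \<in> {1, 2}}"
  have mod4: "y mod 4 \<in> {1, 2} \<longleftrightarrow> (y + 2) mod 4 \<notin> {1, 2}" for y :: nat
    by simp presburger
  have "(x + k) mod 4 \<in> {1, 2} \<longleftrightarrow> (x + (k + 2)) mod 4 \<notin> {1, 2}" for x :: nat
    using mod4 [of "x + k"] by (simp only: add.assoc)
  then have "?A k \<union> ?A (k + 2) = {..<3 ^ m}" "?A k \<inter> ?A (k + 2) = {}"
    by blast+
  moreover have "finite (?A k)" "finite (?A (k + 2))" by auto
  ultimately have "card (?A k) + card (?A (k + 2)) = card {..<3 ^ m :: nat}"
    using card_Un_disjoint [of "?A k" "?A (k + 2)"] by presburger
  then show ?thesis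
    by (simp add: w3_count_def)
qed

text \<open>Removing the lowest digit a raises the offset by a, which is why the count carries one.
  The terms for a = 0 and a = 2 add up to 3^m by the partition.\<close>

lemma w3_count_Suc: "w3_count (Suc m) k = 3 ^ m + w3_count m (k + 1)"
proof -
  let ?A = "\<lambda>m k. {j. j < 3 ^ m \<and> (w3 m j + k) mod 4 \<in> {1, 2}}"
  let ?f = "\<lambda>a j. 3 * j + a :: nat"
  have "?A (Suc m) k = (\<Union>a<3. ?f a ` ?A m (k + a))" (is "?L = ?R")
  proof (intro equalityI subsetI)
    fix j assume j: "j \<in> ?L"
    then have "j div 3 \<in> ?A m (k + j mod 3)"
      by (auto simp: w3_Suc less_mult_imp_div_less ac_simps)
    then have "?f (j mod 3) (j div 3) \<in> ?f (j mod 3) ` ?A m (k + j mod 3)"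
      by (rule imageI)
    then show "j \<in> ?R" by (intro UN_I [of "j mod 3"]) simp_all
  next
    fix j assume "j \<in> ?R"
    then obtain a i where "a < 3" "j = 3 * i + a" "i \<in> ?A m (k + a)" by blast
    then show "j \<in> ?L" by (simp add: w3_Suc ac_simps)
  qed
  moreover have "card (\<Union>a<3. ?f a ` ?A m (k + a)) = (\<Sum>a<3. card (?f a ` ?A m (k + a)))"
  proof (rule card_UN_disjoint)
    show "\<forall>a\<in>{..<3}. \<forall>b\<in>{..<3}. a \<noteq> b \<longrightarrow> ?f a ` ?A m (k + a) \<inter> ?f b ` ?A m (k + b) = {}"
    proof (intro ballI impI)
      fix a b :: nat assume ab: "a \<in> {..<3}" "b \<in> {..<3}" "a \<noteq> b"
      have "?f a i \<noteq> ?f b j" for i j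
      proof
        assume "?f a i = ?f b j"
        then have "?f a i mod 3 = ?f b j mod 3" by simp
        with ab show False by simp
      qed
      then show "?f a ` ?A m (k + a) \<inter> ?f b ` ?A m (k + b) = {}" by blast
    qed
  qed auto
  moreover have "card (?f a ` ?A m (k + a)) = w3_count m (k + a)" for a
    unfolding w3_count_def by (rule card_image) (auto simp: inj_on_def)
  ultimately have "w3_count (Suc m) k = (\<Sum>a<3. w3_count m (k + a))"
    by (simp add: w3_count_def)
  also have "\<dots> = 3 ^ m + w3_count m (k + 1)"
    using w3_count_complement [of m k] by (simp add: numeral_3_eq_3)
  finally show ?thesis .
qed

lemma w3_count_Suc_Suc: "w3_count (m + 2) 0 + w3_count m 0 = 5 * 3 ^ m"
  using w3_count_complement [of m 0] by (simp add: w3_count_Suc numeral_2_eq_2)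

text \<open>The two-step recursion negates the difference of twice the count and 3^m, and this
  difference is 1 at m = 1. Distributing the signs over both sides avoids subtraction of
  naturals.\<close>

lemma w3_count_odd:
  assumes "odd m"
  shows "2 * w3_count m 0 + (if m mod 4 = 3 then 1 else 0) = 3 ^ m + (if m mod 4 = 1 then 1 else 0)"
proof -
  have "2 * w3_count (2 * q + 1) 0 + (if odd q then 1 else 0) =
      3 ^ (2 * q + 1) + (if even q then 1 else 0)" for q
  proof (induction q)
    case 0
    have "w3_count 1 0 = 2"
      using w3_count_Suc [of 0 0] by (simp add: w3_count_def)
    then show ?case by simp
  next
    case (Suc q)
    have "w3_count (2 * Suc q + 1) 0 + w3_count (2 * q + 1) 0 = 5 * 3 ^ (2 * q + 1)"
      using w3_count_Suc_Suc [of "2 * q + 1"] by (simp add: algebra_simps del: power_Suc)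
    moreover have "(3::nat) ^ (2 * Suc q + 1) = 9 * 3 ^ (2 * q + 1)"
      by simp
    moreover have "2 * x + (if odd (Suc q) then 1 else 0) = u + (if even (Suc q) then 1 else 0)"
      if "x + y = 5 * t" "u = 9 * t"
        "2 * y + (if odd q then 1 else 0) = t + (if even q then 1 else 0)" for x y t u :: nat
      using that by (cases "even q") auto
    ultimately show ?case
      using Suc.IH by blast
  qed
  moreover obtain q where m: "m = 2 * q + 1" using assms by (elim oddE)
  moreover have mod4: "(2 * q + 1) mod 4 = 3 \<longleftrightarrow> odd q" "(2 * q + 1) mod 4 = 1 \<longleftrightarrow> even q"
    by presburger+
  ultimately show ?thesis by (simp only: m mod4)
qed

lemma even_w3_iff: "j < 3 ^ m \<Longrightarrow> even (w3 m j) \<longleftrightarrow> even j"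
proof (induction m arbitrary: j)
  case (Suc m)
  then have "even (w3 m (j div 3)) \<longleftrightarrow> even (j div 3)"
    by (simp add: less_mult_imp_div_less)
  moreover have "even j \<longleftrightarrow> even (j mod 3 + j div 3)"
    by presburger
  ultimately show ?case by (simp add: w3_Suc)
qed simp

lemma T_set_subset: "T_set i1 i2 m \<subseteq> {1..<3 ^ m - 1}"
  by (auto simp: T_set_def)

text \<open>For odd m the excess 1 is the exponent 3^m - 1: its weight 2m is 2 modulo 4, but it lies
  beyond the range of \<open>T_set\<close>. The exponent 0 has weight 0 and is in neither
  set.\<close>

lemma card_T_set_1_2:
  assumes "odd m"
  shows "card (T_set 1 2 m) + 1 = w3_count m 0"
proof -
  let ?S = "{j. j < 3 ^ m \<and> (w3 m j + 0) mod 4 \<in> {1, 2}}"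
  have "w3 m (3 ^ m - 1) = 2 * m"
    using w3_complement [of 0 m] by simp
  moreover have "2 * m mod 4 = 2" using assms by presburger
  ultimately have "(3 ^ m - 1 :: nat) \<in> ?S" by simp
  moreover have "T_set 1 2 m = ?S - {3 ^ m - 1}"
  proof (intro equalityI subsetI)
    fix j assume "j \<in> ?S - {3 ^ m - 1}"
    moreover from this have "j \<noteq> 0" by (intro notI) simp
    ultimately show "j \<in> T_set 1 2 m" by (auto simp: T_set_def)
  qed (use T_set_subset in \<open>fastforce simp: T_set_def\<close>)
  moreover have "finite ?S" by simp
  ultimately show ?thesis
    using card_Suc_Diff1 [of ?S "3 ^ m - 1"] by (simp only: w3_count_def Suc_eq_plus1)
qed

section \<open>Polynomials and the BCH bound\<close>

lemma linear_factors_dvd_iff: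
  fixes f :: "'b \<Rightarrow> 'a::field"
  assumes "finite A" "inj_on f A"
  shows "(\<Prod>x\<in>A. [:- f x, 1:]) dvd p \<longleftrightarrow> (\<forall>x\<in>A. poly p (f x) = 0)"
proof
  assume "(\<Prod>x\<in>A. [:- f x, 1:]) dvd p"
  moreover have "[:- f x, 1:] dvd (\<Prod>x\<in>A. [:- f x, 1:])" if "x \<in> A" for x
    by (rule dvd_prodI [OF assms(1) that])
  ultimately show "\<forall>x\<in>A. poly p (f x) = 0"
    by (meson dvd_trans poly_eq_0_iff_dvd)
next
  assume "\<forall>x\<in>A. poly p (f x) = 0"
  with assms show "(\<Prod>x\<in>A. [:- f x, 1:]) dvd p"
  proof (induction A arbitrary: p rule: finite_induct)
    case (insert y A)
    from insert.prems obtain q where q: "p = [:- f y, 1:] * q"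
      by (auto simp: poly_eq_0_iff_dvd elim: dvdE)
    have "\<forall>x\<in>A. poly q (f x) = 0"
      using insert.prems insert.hyps by (auto simp: q) (metis imageI)
    then have "(\<Prod>x\<in>A. [:- f x, 1:]) dvd q"
      using insert by (simp add: inj_on_def)
    then show ?case
      unfolding q prod.insert [OF insert.hyps] by (rule mult_dvd_mono [OF dvd_refl])
  qed simp
qed

lemma degree_linear_factors:
  "finite A \<Longrightarrow> degree (\<Prod>x\<in>A. [:- f x, 1::'a::field:]) = card A"
  by (subst degree_prod_sum_eq) auto

text \<open>Combining the vanishing power sums linearly gives a vanishing sum for every polynomial
  of degree below \<open>card I\<close>; the product of the X - x l over the other indices isolates
  the term at i.\<close>

lemma vandermonde_trivial_kernel:
  fixes f x :: "'b \<Rightarrow> 'a::field"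
  assumes "finite I" "inj_on x I" "i \<in> I"
    and zero: "\<And>k. k < card I \<Longrightarrow> (\<Sum>i\<in>I. f i * x i ^ k) = 0"
  shows "f i = 0"
proof -
  define p where "p = (\<Prod>l\<in>I - {i}. [:- x l, 1:])"
  have "card (I - {i}) < card I"
    using assms(1,3) by (rule card_Diff1_less)
  then have "degree p < card I"
    using assms(1) by (simp only: p_def degree_linear_factors finite_Diff)
  then have "(\<Sum>l\<in>I. f l * (coeff p k * x l ^ k)) = 0" if "k \<le> degree p" for k
    using zero [of k] that
    by (simp add: mult.left_commute [of _ "coeff p k"] flip: sum_distrib_left)
  then have "(\<Sum>l\<in>I. f l * poly p (x l)) = 0"
    by (simp add: poly_altdef sum_distrib_left sum.swap [of _ _ I])
  moreover have "poly p (x l) = 0" if "l \<in> I - {i}" for l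
    using that assms by (auto simp: p_def poly_prod)
  ultimately have "f i * poly p (x i) = 0"
    using assms by (simp add: sum.remove [of I i])
  moreover have "poly p (x i) \<noteq> 0"
    using assms by (auto simp: p_def poly_prod inj_on_def)
  ultimately show ?thesis by simp
qed

text \<open>If the support of f had at most \<delta> points, the equations would contain a
  Vandermonde system on it, and f would vanish on its own support.\<close>

lemma bch_bound:
  fixes f x :: "nat \<Rightarrow> 'a::field"
  assumes inj: "inj_on x {..<N}"
    and zero: "\<And>k. k < \<delta> \<Longrightarrow> (\<Sum>i<N. f i * x i ^ k) = 0"
    and nz: "\<exists>i<N. f i \<noteq> 0"
  shows "\<delta> < card {i. i < N \<and> f i \<noteq> 0}"
proof (rule ccontr)
  let ?I = "{i. i < N \<and> f i \<noteq> 0}"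
  assume *: "\<not> ?thesis"
  obtain i where i: "i \<in> ?I" using nz by blast
  have "(\<Sum>i\<in>?I. f i * x i ^ k) = 0" if "k < card ?I" for k
  proof -
    have "(\<Sum>i\<in>?I. f i * x i ^ k) = (\<Sum>i<N. f i * x i ^ k)"
      by (rule sum.mono_neutral_left) auto
    then show ?thesis using zero [of k] that * by simp
  qed
  moreover have "inj_on x ?I" "finite ?I"
    using inj by (auto simp: inj_on_def)
  ultimately have "f i = 0"
    using i vandermonde_trivial_kernel [of ?I x i f] by blast
  with i show False by simp
qed

section \<open>Coefficient vectors as polynomials, and ranges of even length\<close>

lemma coeff_poly_of_vec: "coeff (poly_of_vec n c) i = (if i < n then c i else 0)"
  by (simp add: poly_of_vec_def coeff_sum)

lemma poly_poly_of_vec: "poly (poly_of_vec n c) x = (\<Sum>i<n. c i * x ^ i)"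
  by (simp add: poly_of_vec_def poly_sum poly_monom)

lemma poly_of_vec_coeff: "degree p < n \<Longrightarrow> poly_of_vec n (coeff p) = p"
  by (intro poly_eqI) (simp add: coeff_poly_of_vec coeff_eq_0)

lemma degree_poly_of_vec_less: "0 < n \<Longrightarrow> degree (poly_of_vec n c) < n"
  by (intro degree_lessI) (auto simp: coeff_poly_of_vec)

lemma card_vecs: "card (vecs k :: (nat \<Rightarrow> 'a::field) set) = card (F3 :: 'a set) ^ k"
proof -
  have "bij_betw (\<lambda>c. restrict c {..<k}) (vecs k) ({..<k} \<rightarrow>\<^sub>E (F3 :: 'a set))"
    by (rule bij_betw_byWitness [where f' = "\<lambda>f i. if i < k then f i else 0"])
      (auto simp: vecs_def PiE_def extensional_def fun_eq_iff)
  then show ?thesis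
    by (simp add: bij_betw_same_card card_funcsetE)
qed

lemma sum_lessThan_double:
  fixes f :: "nat \<Rightarrow> 'b::comm_monoid_add"
  shows "(\<Sum>i<N + N. f i) = (\<Sum>i<N. f i + f (i + N))"
proof -
  have "(\<Sum>i<N + M. f i) = (\<Sum>i<N. f i) + (\<Sum>i<M. f (i + N))" for M
    by (induction M) (simp_all add: ac_simps)
  then show ?thesis by (simp add: sum.distrib)
qed

lemma card_Collect_less_double:
  fixes N :: nat
  shows "card {i. i < N + N \<and> P i} = card {i. i < N \<and> P i} + card {i. i < N \<and> P (i + N)}"
proof -
  have "card {i. i < K \<and> Q i} = (\<Sum>i<K. if Q i then 1 else 0)" for K :: nat and Q
    by (simp flip: sum.inter_filter)
  then show ?thesis
    by (simp add: sum_lessThan_double sum.distrib)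
qed

section \<open>Fields of order a power of 3 and their cyclic codes\<close>

locale ternary_field =
  fixes \<alpha> :: "'a::{finite,field}" and m n :: nat
  assumes card_field: "CARD('a) = 3 ^ m"
    and primitive: "\<And>x::'a. x \<noteq> 0 \<Longrightarrow> \<exists>j. x = \<alpha> ^ j"
    and m_pos: "0 < m"
    and n_eq: "n = 3 ^ m - 1"
begin

lemma n_pos: "0 < n"
  using m_pos power_gt1_lemma [of "3::nat" "m - 1"] by (simp add: n_eq flip: power_Suc)

text \<open>Translation by 1 permutes the field, so comparing the sums over all elements gives 3^m =
  0 in the field, hence 3 = 0.\<close>

lemma char_3: "CHAR('a) = 3"
proof -
  have "(\<Sum>x::'a\<in>UNIV. x + 1) = (\<Sum>x::'a\<in>UNIV. x)"
    by (rule sum.reindex_bij_betw) (rule bij_betw_byWitness [where f' = "\<lambda>x. x - 1"], auto)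
  then have "(of_nat CARD('a) :: 'a) = 0"
    by (simp add: sum.distrib)
  then have "of_nat 3 = (0::'a)"
    by (simp add: card_field)
  then have "CHAR('a) dvd 3"
    by (simp only: of_nat_eq_0_iff_char_dvd)
  moreover have "prime (3::nat)" by simp
  ultimately have "CHAR('a) = 1 \<or> CHAR('a) = 3"
    using prime_nat_iff by blast
  then show ?thesis by simp
qed

lemma of_nat_eq_0_iff: "(of_nat k :: 'a) = 0 \<longleftrightarrow> 3 dvd k"
  using of_nat_eq_0_iff_char_dvd [where 'a = 'a] by (simp add: char_3)

lemma three_eq_0: "(3::'a) = 0"
  using of_nat_eq_0_iff [of 3] by simp

lemma two_eq_minus_1: "(2::'a) = - 1"
  using three_eq_0 by (simp add: eq_neg_iff_add_eq_0)

lemma cube_add: "(x + y) ^ 3 = x ^ 3 + (y::'a) ^ 3"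
proof -
  have "(x + y) ^ 3 = x ^ 3 + y ^ 3 + 3 * (x ^ 2 * y + x * y ^ 2)"
    by (simp add: power3_eq_cube power2_eq_square algebra_simps)
  then show ?thesis by (simp add: three_eq_0)
qed

lemma cube_sum: "(sum f A) ^ 3 = (\<Sum>i\<in>A. (f i :: 'a) ^ 3)"
  by (induction A rule: infinite_finite_induct) (simp_all add: cube_add)

lemma cube_eq_iff: "x ^ 3 = y ^ 3 \<longleftrightarrow> x = (y::'a)"
proof
  assume "x ^ 3 = y ^ 3"
  moreover have "x ^ 3 = (x - y) ^ 3 + y ^ 3"
    using cube_add [of "x - y" y] by simp
  ultimately show "x = y" by simp
qed simp

lemma frobenius_sum: "(sum f A) ^ (3 ^ t) = (\<Sum>i\<in>A. (f i :: 'a) ^ (3 ^ t))"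
proof (induction t)
  case (Suc t)
  have "(sum f A) ^ (3 ^ Suc t) = ((sum f A) ^ (3 ^ t)) ^ 3"
    by (simp add: power_mult [symmetric] mult.commute)
  then show ?case
    by (simp add: Suc cube_sum power_mult [symmetric] mult.commute)
qed simp

lemma F3_iff: "(x::'a) \<in> F3 \<longleftrightarrow> x ^ 3 = x"
proof
  assume "x \<in> F3"
  then obtain k where x: "x = of_nat k" by (auto simp: F3_def)
  have "(of_nat k :: 'a) ^ 3 = of_nat k"
    by (induction k) (simp_all add: cube_add)
  then show "x ^ 3 = x" by (simp add: x)
next
  assume "x ^ 3 = x"
  then have "x * (x - 1) * (x + 1) = 0"
    by (simp add: power3_eq_cube algebra_simps)
  then have "x = 0 \<or> x = 1 \<or> x = - 1"
    by (auto simp: eq_neg_iff_add_eq_0)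
  then have "x = of_nat 0 \<or> x = of_nat 1 \<or> x = of_nat 2"
    using two_eq_minus_1 by auto
  then show "x \<in> F3" unfolding F3_def by blast
qed

lemma zero_F3: "(0::'a) \<in> F3"
  by (simp add: F3_iff)

lemma add_F3: "x \<in> F3 \<Longrightarrow> y \<in> F3 \<Longrightarrow> x + (y::'a) \<in> F3"
  by (simp add: F3_iff cube_add)

lemma F3_power: "(x::'a) \<in> F3 \<Longrightarrow> x ^ (3 ^ t) = x"
  by (induction t) (simp_all add: F3_iff power_mult)

lemma F3_square: "(x::'a) \<in> F3 \<Longrightarrow> x\<^sup>2 = (if x = 0 then 0 else 1)"
  by (auto simp: F3_iff power3_eq_cube power2_eq_square)

lemma card_F3: "card (F3 :: 'a set) = 3"
proof -
  have "x \<in> F3 \<longleftrightarrow> x \<in> {0, 1, - 1}" for x :: 'a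
  proof
    assume "x \<in> F3"
    then have "x * (x - 1) * (x + 1) = 0"
      by (simp add: F3_iff power3_eq_cube algebra_simps)
    then show "x \<in> {0, 1, - 1}" by (auto simp: eq_neg_iff_add_eq_0)
  qed (auto simp: F3_iff)
  then have F3: "(F3 :: 'a set) = {0, 1, - 1}" by blast
  have "(1::'a) \<noteq> - 1"
    using of_nat_eq_0_iff [of 2] by (simp add: eq_neg_iff_add_eq_0)
  then show ?thesis by (simp add: F3)
qed

section \<open>The primitive element as a root of unity of order n\<close>

lemma alpha_nz: "\<alpha> \<noteq> 0"
proof
  assume "\<alpha> = 0"
  have "x \<in> {0, 1}" for x :: 'a
  proof (cases "x = 0")
    case False
    then obtain j where "x = 0 ^ j" using primitive \<open>\<alpha> = 0\<close> by blast
    with False show ?thesis by (cases j) auto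
  qed simp
  then have "CARD('a) \<le> card {0, 1 :: 'a}"
    by (intro card_mono) auto
  then have "3 ^ m \<le> (2::nat)" by (simp add: card_field)
  with n_pos show False
    using power_increasing [of 1 m "3::nat"] m_pos by simp
qed

text \<open>Multiplication by \<alpha> permutes the n nonzero elements, so their nonzero product is
  unchanged by the factor \<alpha>^n.\<close>

lemma alpha_pow_n: "\<alpha> ^ n = 1"
proof -
  let ?U = "UNIV - {0::'a}"
  have "bij_betw ((*) \<alpha>) ?U ?U"
    by (rule bij_betw_byWitness [where f' = "\<lambda>x. x / \<alpha>"]) (use alpha_nz in auto)
  then have "(\<Prod>x\<in>?U. \<alpha> * x) = \<Prod>?U"
    by (rule prod.reindex_bij_betw)
  moreover have "\<Prod>?U \<noteq> 0" by simp
  moreover have "card ?U = n"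
    by (simp add: card_field n_eq card_Diff_singleton)
  ultimately show ?thesis by (simp add: prod.distrib)
qed

lemma alpha_pow_add_mult_n: "\<alpha> ^ (k + n * l) = \<alpha> ^ k"
  by (simp add: power_add power_mult alpha_pow_n)

lemma alpha_pow_mod: "\<alpha> ^ (k mod n) = \<alpha> ^ k"
  using alpha_pow_add_mult_n [of "k mod n" "k div n"] by simp

lemma alpha_pow_cong: "[k = l] (mod n) \<Longrightarrow> \<alpha> ^ k = \<alpha> ^ l"
  unfolding cong_def by (metis alpha_pow_mod)

lemma inj_alpha: "inj_on ((^) \<alpha>) {..<n}"
proof (rule eq_card_imp_inj_on)
  have "((^) \<alpha>) ` {..<n} = UNIV - {0}"
  proof (intro equalityI subsetI)
    fix x :: 'a assume "x \<in> UNIV - {0}"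
    then obtain j where "x = \<alpha> ^ (j mod n)"
      using primitive [of x] by (auto simp: alpha_pow_mod)
    then show "x \<in> ((^) \<alpha>) ` {..<n}" using n_pos by simp
  qed (use alpha_nz in auto)
  then show "card (((^) \<alpha>) ` {..<n}) = card {..<n}"
    by (simp add: card_field n_eq card_Diff_singleton)
qed simp

lemma alpha_pow_eq_1_iff: "\<alpha> ^ k = 1 \<longleftrightarrow> n dvd k"
proof
  assume "\<alpha> ^ k = 1"
  then have "\<alpha> ^ (k mod n) = \<alpha> ^ 0" by (simp add: alpha_pow_mod)
  then have "k mod n = 0"
    using inj_onD [OF inj_alpha, of "k mod n" 0] n_pos by simp
  then show "n dvd k" by auto
qed (auto simp: power_mult alpha_pow_n)

text \<open>A geometric sum whose ratio \<alpha>^k has n-th power 1. In the exceptional case all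
  terms are 1, and n = 3^m - 1 equals -1 in characteristic 3.\<close>

lemma sum_alpha_powers: "(\<Sum>i<n. \<alpha> ^ (i * k)) = (if n dvd k then - 1 else 0)"
proof (cases "n dvd k")
  case True
  then have "\<alpha> ^ (i * k) = 1" for i by (simp add: alpha_pow_eq_1_iff)
  moreover have "(of_nat n :: 'a) = - 1"
    using m_pos by (simp add: n_eq of_nat_diff three_eq_0)
  ultimately show ?thesis using True by simp
next
  case False
  then have "\<alpha> ^ k \<noteq> 1" by (simp add: alpha_pow_eq_1_iff)
  moreover have "(\<alpha> ^ k) ^ n = 1"
    by (simp add: alpha_pow_eq_1_iff flip: power_mult)
  ultimately show ?thesis
    using False by (simp add: mult.commute [of _ k] power_mult geometric_sum)
qed

section \<open>The discrete Fourier transform and Parseval's identity\<close>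

definition dft :: "(nat \<Rightarrow> 'a) \<Rightarrow> nat \<Rightarrow> 'a" where
  "dft c j = (\<Sum>i<n. c i * \<alpha> ^ (i * j))"

lemma poly_poly_of_vec_alpha: "poly (poly_of_vec n c) (\<alpha> ^ j) = dft c j"
  by (simp add: poly_poly_of_vec dft_def mult.commute flip: power_mult)

lemma dft_mod: "dft c (j mod n) = dft c j"
  unfolding dft_def
  by (intro sum.cong refl arg_cong [where f = "(*) _"] alpha_pow_cong)
    (simp add: cong_def mod_mult_right_eq)

text \<open>After expanding both transforms, the sum over j runs over the powers of \<alpha>^(i - k)
  and vanishes unless i = k; the minus sign is n = -1 in the field. Negative indices are written as
  n - j and n - k to stay within the naturals.\<close>

lemma parseval: "(\<Sum>j<n. dft c j * dft d (n - j)) = - (\<Sum>i<n. c i * d i)"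
proof -
  have exp: "\<alpha> ^ (i * j) * \<alpha> ^ (k * (n - j)) = \<alpha> ^ (j * (i + (n - k)))"
    if jk: "j < n" "k < n" for i j k
  proof -
    obtain j' k' where nj: "n = j + j'" and nk: "n = k + k'"
      using jk by (meson less_imp_le le_Suc_ex)
    have "k' * n = k' * j + k' * j'" unfolding nj by (rule distrib_left)
    moreover have "j' * n = j' * k + j' * k'" unfolding nk by (rule distrib_left)
    ultimately have "i * j + k * j' + k' * n = j * (i + k') + j' * n"
      by (simp only: distrib_left ac_simps)
    then have "(i * j + k * j' + k' * n) mod n = (j * (i + k') + j' * n) mod n"
      by (rule arg_cong)
    then have "[i * j + k * j' = j * (i + k')] (mod n)"
      by (simp only: cong_def mod_mult_self1)
    then show ?thesis
      using alpha_pow_cong diff_add_inverse [of j j'] diff_add_inverse [of k k']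
      by (simp only: nj [symmetric] nk [symmetric] power_add [symmetric])
  qed
  have "(\<Sum>j<n. dft c j * dft d (n - j)) =
      (\<Sum>j<n. \<Sum>i<n. \<Sum>k<n. c i * d k * \<alpha> ^ (j * (i + (n - k))))"
    unfolding dft_def sum_product
  proof (intro sum.cong refl)
    fix j i k assume "j \<in> {..<n}" "k \<in> {..<n}"
    then have "\<alpha> ^ (j * (i + (n - k))) = \<alpha> ^ (i * j) * \<alpha> ^ (k * (n - j))"
      by (intro exp [symmetric]) simp_all
    then show "c i * \<alpha> ^ (i * j) * (d k * \<alpha> ^ (k * (n - j))) =
        c i * d k * \<alpha> ^ (j * (i + (n - k)))"
      by (simp only: ac_simps)
  qed
  also have "\<dots> = (\<Sum>i<n. \<Sum>j<n. \<Sum>k<n. c i * d k * \<alpha> ^ (j * (i + (n - k))))"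
    by (rule sum.swap)
  also have "\<dots> = (\<Sum>i<n. \<Sum>k<n. \<Sum>j<n. c i * d k * \<alpha> ^ (j * (i + (n - k))))"
    by (rule sum.cong [OF refl sum.swap])
  also have "\<dots> = (\<Sum>i<n. \<Sum>k<n. c i * d k * (if n dvd i + (n - k) then - 1 else 0))"
    by (simp add: sum_alpha_powers flip: sum_distrib_left)
  also have "\<dots> = (\<Sum>i<n. \<Sum>k<n. if i = k then - (c i * d i) else 0)"
  proof (intro sum.cong refl)
    fix i k assume "i \<in> {..<n}" "k \<in> {..<n}"
    then have "n dvd i + (n - k) \<longleftrightarrow> i = k"
    proof -
      have "n dvd i + (n - k) \<longleftrightarrow> [i + (n - k) = k + (n - k)] (mod n)"
        using \<open>k \<in> {..<n}\<close> by (simp add: cong_def mod_eq_0_iff_dvd)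
      also have "\<dots> \<longleftrightarrow> i = k"
        using \<open>i \<in> {..<n}\<close> \<open>k \<in> {..<n}\<close>
        by (simp only: cong_add_rcancel_nat) (auto simp: cong_def)
      finally show ?thesis .
    qed
    then show "c i * d k * (if n dvd i + (n - k) then - 1 else 0) =
        (if i = k then - (c i * d i) else 0)" by simp
  qed
  also have "\<dots> = - (\<Sum>i<n. c i * d i)"
    by (simp add: sum_negf)
  finally show ?thesis .
qed

section \<open>Frobenius acting on coefficients, and codes given by their zeros\<close>

definition frob_poly :: "'a poly \<Rightarrow> 'a poly" where
  "frob_poly p = map_poly (\<lambda>x. x ^ 3) p"

lemma coeff_frob_poly: "coeff (frob_poly p) i = coeff p i ^ 3"
  by (simp add: frob_poly_def coeff_map_poly)

lemma frob_poly_mult: "frob_poly (p * q) = frob_poly p * frob_poly q"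
  by (intro poly_eqI) (simp add: coeff_frob_poly coeff_mult cube_sum power_mult_distrib)

lemma frob_poly_prod: "frob_poly (prod f A) = (\<Prod>x\<in>A. frob_poly (f x))"
proof (induction A rule: infinite_finite_induct)
  case (insert x A)
  then show ?case by (simp add: frob_poly_mult)
qed (auto intro!: poly_eqI simp: coeff_frob_poly)

lemma frob_poly_linear: "frob_poly [:- x, 1:] = [:- (x ^ 3), 1:]"
  by (intro poly_eqI) (simp add: coeff_frob_poly coeff_pCons split: nat.split)

lemma frob_poly_fixed_iff: "frob_poly p = p \<longleftrightarrow> (\<forall>i. coeff p i \<in> F3)"
  by (simp add: poly_eq_iff coeff_frob_poly F3_iff)

definition gpoly :: "nat set \<Rightarrow> 'a poly" where
  "gpoly Z = (\<Prod>j\<in>Z. [:- (\<alpha> ^ j), 1:])"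

text \<open>Unions of 3-cyclotomic cosets, for which \<open>gpoly\<close> has its coefficients in
  \<open>F3\<close>.\<close>

definition frob_closed :: "nat set \<Rightarrow> bool" where
  "frob_closed Z \<longleftrightarrow> Z \<subseteq> {..<n} \<and> (\<forall>j\<in>Z. 3 * j mod n \<in> Z)"

definition zero_code :: "nat set \<Rightarrow> (nat \<Rightarrow> 'a) set" where
  "zero_code Z = {c \<in> vecs n. \<forall>j\<in>Z. dft c j = 0}"

lemma frob_closed_finite: "frob_closed Z \<Longrightarrow> finite Z"
  by (auto simp: frob_closed_def intro: finite_subset)

lemma frob_closed_mult_pow3: "frob_closed Z \<Longrightarrow> j \<in> Z \<Longrightarrow> j * 3 ^ t mod n \<in> Z"
proof (induction t)
  case 0
  then show ?case by (auto simp: frob_closed_def)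
next
  case (Suc t)
  have "j * 3 ^ Suc t mod n = 3 * (j * 3 ^ t mod n) mod n"
    by (simp add: mod_mult_right_eq mult.left_commute)
  then show ?case using Suc by (simp add: frob_closed_def)
qed

text \<open>Cubing the coefficients cubes the roots, and multiplication by 3 modulo n permutes Z: it
  is injective there because cubing is injective in the field.\<close>

lemma frob_poly_gpoly:
  assumes Z: "frob_closed Z"
  shows "frob_poly (gpoly Z) = gpoly Z"
proof -
  have "inj_on (\<lambda>j. 3 * j mod n) Z"
  proof (rule inj_onI)
    fix i j assume ij: "i \<in> Z" "j \<in> Z" "3 * i mod n = 3 * j mod n"
    then have "\<alpha> ^ (3 * i) = \<alpha> ^ (3 * j)"
      by (metis alpha_pow_mod)
    then have "(\<alpha> ^ i) ^ 3 = (\<alpha> ^ j) ^ 3"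
      by (simp add: mult.commute flip: power_mult)
    then have "\<alpha> ^ i = \<alpha> ^ j" by (simp only: cube_eq_iff)
    then show "i = j"
      using inj_alpha ij Z by (auto simp: frob_closed_def dest: inj_onD)
  qed
  moreover have "(\<lambda>j. 3 * j mod n) ` Z \<subseteq> Z"
    using Z by (auto simp: frob_closed_def)
  ultimately have "bij_betw (\<lambda>j. 3 * j mod n) Z Z"
    using endo_inj_surj [OF frob_closed_finite [OF Z]] by (simp add: bij_betw_def)
  then have "gpoly Z = (\<Prod>j\<in>Z. [:- (\<alpha> ^ (3 * j mod n)), 1:])"
    unfolding gpoly_def by (rule prod.reindex_bij_betw [symmetric])
  also have "\<dots> = frob_poly (gpoly Z)"
    by (simp add: gpoly_def frob_poly_prod frob_poly_linear alpha_pow_mod mult.commute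
        flip: power_mult)
  finally show ?thesis ..
qed

lemma degree_gpoly: "finite Z \<Longrightarrow> degree (gpoly Z) = card Z"
  by (simp add: gpoly_def degree_linear_factors)

lemma gpoly_nz: "finite Z \<Longrightarrow> gpoly Z \<noteq> 0"
  by (simp add: gpoly_def)

lemma gpoly_dvd_iff:
  assumes "Z \<subseteq> {..<n}"
  shows "gpoly Z dvd p \<longleftrightarrow> (\<forall>j\<in>Z. poly p (\<alpha> ^ j) = 0)"
  unfolding gpoly_def
  using assms by (intro linear_factors_dvd_iff)
    (auto intro: finite_subset inj_on_subset [OF inj_alpha])

lemma zero_code_iff_dvd:
  assumes "frob_closed Z"
  shows "c \<in> zero_code Z \<longleftrightarrow> c \<in> vecs n \<and> gpoly Z dvd poly_of_vec n c"
  using assms by (auto simp: zero_code_def gpoly_dvd_iff frob_closed_def poly_poly_of_vec_alpha)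

text \<open>Frobenius fixes the product and the nonzero factor \<open>gpoly Z\<close>, so it fixes
  the cofactor: division by \<open>gpoly Z\<close> stays over \<open>F3\<close>.\<close>

lemma frob_poly_quotient:
  assumes Z: "frob_closed Z" and p: "frob_poly (gpoly Z * a) = gpoly Z * a"
  shows "frob_poly a = a"
proof -
  have "gpoly Z * frob_poly a = gpoly Z * a"
    using p by (simp add: frob_poly_mult frob_poly_gpoly [OF Z])
  then show ?thesis
    using gpoly_nz [OF frob_closed_finite [OF Z]] by simp
qed

lemma frob_poly_poly_of_vec: "c \<in> vecs n \<Longrightarrow> frob_poly (poly_of_vec n c) = poly_of_vec n c"
  by (simp add: frob_poly_fixed_iff coeff_poly_of_vec vecs_def zero_F3)

text \<open>Reduction modulo X^n - 1 does not change values at the powers of \<alpha>. Conversely, a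
  word with these zeros is a multiple of \<open>gpoly Z\<close> of degree below n, where the
  reduction does nothing.\<close>

lemma cyclic_code_gpoly:
  assumes Z: "frob_closed Z"
  shows "cyclic_code n (gpoly Z) = zero_code Z"
proof (intro equalityI subsetI)
  fix c assume "c \<in> cyclic_code n (gpoly Z)"
  then obtain a where c: "c \<in> vecs n"
    and a: "poly_of_vec n c = (a * gpoly Z) mod (monom 1 n - 1)"
    by (auto simp: cyclic_code_def)
  have "dft c j = 0" if "j \<in> Z" for j
  proof -
    let ?x = "\<alpha> ^ j"
    have "?x ^ n = 1" by (simp add: alpha_pow_eq_1_iff flip: power_mult)
    then have x: "poly (monom 1 n - 1) ?x = 0" by (simp add: poly_monom)
    have "poly (a * gpoly Z) ?x = 0"
      using gpoly_dvd_iff [of Z "a * gpoly Z"] Z that by (simp add: frob_closed_def)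
    moreover have "poly (a * gpoly Z) ?x = poly ((a * gpoly Z) div (monom 1 n - 1) * (monom 1 n - 1)
        + (a * gpoly Z) mod (monom 1 n - 1)) ?x"
      by (simp only: div_mult_mod_eq)
    ultimately show ?thesis
      using x by (simp only: poly_add poly_mult a [symmetric] poly_poly_of_vec_alpha) simp
  qed
  with c show "c \<in> zero_code Z" by (simp add: zero_code_def)
next
  fix c assume "c \<in> zero_code Z"
  then have c: "c \<in> vecs n" and "gpoly Z dvd poly_of_vec n c"
    by (simp_all add: zero_code_iff_dvd [OF Z])
  then obtain a where a: "poly_of_vec n c = gpoly Z * a" by (auto elim: dvdE)
  have "frob_poly a = a"
    using frob_poly_quotient [OF Z] frob_poly_poly_of_vec [OF c] by (simp add: a)
  moreover have "degree (monom 1 n - 1 :: 'a poly) = n"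
    using n_pos degree_add_eq_left [of "- 1" "monom 1 n :: 'a poly"] by (simp add: degree_monom_eq)
  then have "(a * gpoly Z) mod (monom 1 n - 1) = a * gpoly Z"
    using degree_poly_of_vec_less [OF n_pos, of c]
    by (intro mod_poly_less) (simp add: a mult.commute)
  ultimately show "c \<in> cyclic_code n (gpoly Z)"
    using c unfolding cyclic_code_def frob_poly_fixed_iff
    by (auto simp: a mult.commute intro!: exI [of _ a])
qed

text \<open>Multiplication by \<open>gpoly Z\<close> is a bijection from the polynomials over
  \<open>F3\<close> with \<open>n - card Z\<close> coefficients to the codewords.\<close>

lemma card_zero_code:
  assumes Z: "frob_closed Z"
  shows "card (zero_code Z) = 3 ^ (n - card Z)"
proof -
  let ?g = "gpoly Z" and ?k = "n - card Z"
  have fin: "finite Z" and sub: "Z \<subseteq> {..<n}"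
    using Z by (auto simp: frob_closed_def frob_closed_finite)
  have g: "?g \<noteq> 0" "degree ?g = card Z"
    using fin by (simp_all add: gpoly_nz degree_gpoly)
  have cardZ: "card Z \<le> n"
    using card_mono [OF _ sub] by simp
  have deg: "degree (?g * a) < n \<longleftrightarrow> degree a < ?k" if "a \<noteq> 0" for a
    using g cardZ that by (simp add: degree_mult_eq less_diff_conv add.commute)
  have "bij_betw (\<lambda>v. coeff (?g * poly_of_vec ?k v)) (vecs ?k) (zero_code Z)"
    unfolding bij_betw_def
  proof (intro conjI inj_onI equalityI subsetI)
    fix v w assume vw: "v \<in> vecs ?k" "w \<in> vecs ?k"
      and "coeff (?g * poly_of_vec ?k v) = coeff (?g * poly_of_vec ?k w)"
    then have "poly_of_vec ?k v = poly_of_vec ?k w"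
      using g by (simp add: coeff_inject)
    then have "(if i < ?k then v i else 0) = (if i < ?k then w i else 0)" for i
      by (metis coeff_poly_of_vec)
    then have "v i = w i" for i
      using vw by (cases "i < ?k") (auto simp: vecs_def dest: meta_spec [of _ i])
    then show "v = w" by blast
  next
    fix c assume "c \<in> (\<lambda>v. coeff (?g * poly_of_vec ?k v)) ` vecs ?k"
    then obtain v where v: "v \<in> vecs ?k" and c: "c = coeff (?g * poly_of_vec ?k v)" by blast
    let ?p = "?g * poly_of_vec ?k v"
    have "degree ?p < n"
    proof (cases "poly_of_vec ?k v = 0")
      case False
      then have "?k > 0" by (cases "?k > 0") (auto simp: poly_of_vec_def)
      with False show ?thesis by (simp only: deg degree_poly_of_vec_less not_False_eq_True)
    qed (use n_pos in simp)
    then have p: "poly_of_vec n c = ?p" unfolding c by (rule poly_of_vec_coeff)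
    have "frob_poly (poly_of_vec ?k v) = poly_of_vec ?k v"
      using v by (simp add: frob_poly_fixed_iff coeff_poly_of_vec vecs_def zero_F3)
    then have "frob_poly ?p = ?p"
      by (simp add: frob_poly_mult frob_poly_gpoly [OF Z])
    then have "c \<in> vecs n"
      using \<open>degree ?p < n\<close> unfolding c vecs_def frob_poly_fixed_iff
      by (auto intro: coeff_eq_0)
    with p show "c \<in> zero_code Z" by (simp add: zero_code_iff_dvd [OF Z])
  next
    fix c assume "c \<in> zero_code Z"
    then have c: "c \<in> vecs n" and "?g dvd poly_of_vec n c"
      by (simp_all add: zero_code_iff_dvd [OF Z])
    then obtain a where a: "poly_of_vec n c = ?g * a" by (auto elim: dvdE)
    have fa: "frob_poly a = a"
      using frob_poly_quotient [OF Z] frob_poly_poly_of_vec [OF c] by (simp add: a)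
    have a0: "coeff a i = 0" if "i \<ge> ?k" for i
    proof (cases "a = 0")
      case False
      then have "degree a < ?k"
        using deg degree_poly_of_vec_less [OF n_pos, of c] by (simp add: a)
      then show ?thesis using that by (simp add: coeff_eq_0)
    qed simp
    then have "poly_of_vec ?k (coeff a) = a"
      by (intro poly_eqI) (simp add: coeff_poly_of_vec)
    moreover have "coeff a \<in> vecs ?k"
      using fa a0 by (simp add: vecs_def frob_poly_fixed_iff)
    moreover have "c = coeff (poly_of_vec n c)"
      using c by (auto simp: coeff_poly_of_vec vecs_def)
    ultimately show "c \<in> (\<lambda>v. coeff (?g * poly_of_vec ?k v)) ` vecs ?k"
      by (intro image_eqI [of _ _ "coeff a"]) (simp_all add: a)
  qed
  then have "card (zero_code Z) = card (vecs ?k :: (nat \<Rightarrow> 'a) set)"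
    by (simp add: bij_betw_same_card)
  then show ?thesis by (simp add: card_vecs card_F3)
qed

section \<open>The trace and the zeros of the dual code\<close>

lemma pow_3_pow_m: "(x::'a) ^ (3 ^ m) = x"
proof (cases "x = 0")
  case False
  then obtain j where "x = \<alpha> ^ j" using primitive by blast
  then have "x ^ n = 1" by (simp add: alpha_pow_eq_1_iff flip: power_mult)
  moreover have "3 ^ m = Suc n" by (simp add: n_eq)
  ultimately show ?thesis by simp
qed simp

definition trace :: "'a \<Rightarrow> 'a" where
  "trace x = (\<Sum>t<m. x ^ (3 ^ t))"

text \<open>Cubing shifts the summands cyclically, since x^(3^m) = x.\<close>

lemma trace_in_F3: "trace x \<in> F3"
proof -
  have "trace x ^ 3 = (\<Sum>t<m. x ^ (3 ^ Suc t))"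
    by (simp add: trace_def cube_sum mult.commute flip: power_mult)
  also have "\<dots> + x ^ (3 ^ 0) = trace x + x ^ (3 ^ m)"
    unfolding trace_def
    by (subst sum.lessThan_Suc [symmetric], subst sum.lessThan_Suc_shift) (simp add: add.commute)
  finally show ?thesis by (simp add: F3_iff pow_3_pow_m)
qed

lemma trace_sum: "trace (sum f A) = (\<Sum>i\<in>A. trace (f i))"
  unfolding trace_def frobenius_sum by (rule sum.swap)

lemma trace_mult_F3: "c \<in> F3 \<Longrightarrow> trace (c * x) = c * trace x"
  by (simp add: trace_def power_mult_distrib F3_power sum_distrib_left)

text \<open>As a polynomial the trace has degree at most 3^(m - 1) and coefficient 1 at X, so it
  cannot vanish at all 3^m elements.\<close>

lemma trace_nontrivial: "\<exists>x. trace x \<noteq> 0"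
proof (rule ccontr)
  assume *: "\<not> ?thesis"
  define p :: "'a poly" where "p = (\<Sum>t<m. monom 1 (3 ^ t))"
  have "poly p x = trace x" for x
    by (simp add: p_def poly_sum poly_monom trace_def)
  with * have roots: "{x. poly p x = 0} = UNIV" by auto
  have "coeff p 1 = (\<Sum>t<m. if t = 0 then 1 else 0)"
    unfolding p_def coeff_sum by (intro sum.cong) auto
  then have "p \<noteq> 0" using m_pos by auto
  moreover have "degree p \<le> 3 ^ (m - 1)"
    unfolding p_def
    by (intro degree_sum_le) (auto simp: degree_monom_eq intro!: power_increasing)
  ultimately have "CARD('a) \<le> 3 ^ (m - 1)"
    using card_poly_roots_bound [of p] roots by simp
  then show False using m_pos by (simp add: card_field)
qed

text \<open>If d has the zeros on the right, one factor vanishes in every term of Parseval's sum.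
  Conversely, if the transform of d is nonzero at some j in \<open>?Z'\<close>, the word with
  entries \<open>trace (u * \<alpha> ^ (i * j))\<close> has its transform supported at the exponents
  -j 3^t, so it lies in \<open>zero_code Z\<close>, and its inner product with d is a nonzero
  trace.\<close>

lemma dual_zero_code:
  assumes Z: "frob_closed Z"
  shows "dual_code n (zero_code Z) = zero_code {j. j < n \<and> (n - j) mod n \<notin> Z}"
    (is "_ = zero_code ?Z'")
proof (intro equalityI subsetI)
  fix d assume d: "d \<in> zero_code ?Z'"
  have "(\<Sum>i<n. c i * d i) = 0" if c: "c \<in> zero_code Z" for c
  proof -
    have "dft c j * dft d (n - j) = 0" if "j < n" for j
    proof (cases "j \<in> Z")
      case False
      have "(n - (n - j) mod n) mod n = j"
        using that by (cases "j = 0") auto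
      with False that have "(n - j) mod n \<in> ?Z'" by simp
      then have "dft d ((n - j) mod n) = 0" using d by (simp add: zero_code_def)
      then show ?thesis by (simp add: dft_mod)
    qed (use c in \<open>simp add: zero_code_def\<close>)
    then have "(\<Sum>j<n. dft c j * dft d (n - j)) = 0"
      by (intro sum.neutral) simp
    then show ?thesis using parseval [of c d] by simp
  qed
  then show "d \<in> dual_code n (zero_code Z)"
    using d by (simp add: dual_code_def zero_code_def)
next
  fix d assume "d \<in> dual_code n (zero_code Z)"
  then have dv: "d \<in> vecs n" and orth: "\<And>c. c \<in> zero_code Z \<Longrightarrow> (\<Sum>i<n. c i * d i) = 0"
    by (auto simp: dual_code_def)
  have "dft d j = 0" if j: "j \<in> ?Z'" for j
  proof (rule ccontr)
    assume nz: "dft d j \<noteq> 0"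
    obtain y where y: "trace y \<noteq> 0" using trace_nontrivial by blast
    \<comment> \<open>Scaled so that u times the transform of d at j is y, whose trace is
      nonzero.\<close>
    define u where "u = y / dft d j"
    define c where "c i = (if i < n then trace (u * \<alpha> ^ (i * j)) else 0)" for i
    have "dft c l = 0" if l: "l \<in> Z" for l
    proof -
      have "dft c l = (\<Sum>i<n. \<Sum>t<m. u ^ (3 ^ t) * \<alpha> ^ (i * (j * 3 ^ t + l)))"
        unfolding dft_def
        by (intro sum.cong refl) (simp add: c_def trace_def sum_distrib_right power_mult_distrib
            distrib_left power_add mult.assoc flip: power_mult)
      also have "\<dots> = (\<Sum>t<m. u ^ (3 ^ t) * (\<Sum>i<n. \<alpha> ^ (i * (j * 3 ^ t + l))))"
        by (simp add: sum_distrib_left sum.swap [of _ "{..<m}"])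
      also have "\<dots> = 0"
      proof (intro sum.neutral ballI)
        fix t assume t: "t \<in> {..<m}"
        \<comment> \<open>Multiplying by 3^(m - t), where 3^m is 1 modulo n, would make -j congruent
          to l 3^(m - t), which lies in Z by closure.\<close>
        have "\<not> n dvd j * 3 ^ t + l"
        proof
          assume "n dvd j * 3 ^ t + l"
          then have "n dvd (j * 3 ^ t + l) * 3 ^ (m - t)" by simp
          moreover have "(3::nat) ^ t * 3 ^ (m - t) = n + 1"
            using t by (simp add: n_eq flip: power_add)
          ultimately have "n dvd j * (n + 1) + l * 3 ^ (m - t)"
            by (simp only: distrib_right mult.assoc)
          then have "n dvd j * n + (j + l * 3 ^ (m - t))"
            by (simp add: algebra_simps)
          then have "n dvd j + l * 3 ^ (m - t)"
            by (simp only: dvd_add_right_iff dvd_triv_right)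
          then have "[j + l * 3 ^ (m - t) = j + (n - j)] (mod n)"
            using j by (simp add: cong_def mod_eq_0_iff_dvd)
          then have "l * 3 ^ (m - t) mod n = (n - j) mod n"
            by (simp only: cong_add_lcancel_nat) (simp only: cong_def)
          then show False
            using j frob_closed_mult_pow3 [OF Z l, of "m - t"] by simp
        qed
        then show "u ^ (3 ^ t) * (\<Sum>i<n. \<alpha> ^ (i * (j * 3 ^ t + l))) = 0"
          by (simp add: sum_alpha_powers)
      qed
      finally show ?thesis .
    qed
    then have "c \<in> zero_code Z"
      by (simp add: zero_code_def vecs_def c_def trace_in_F3)
    then have "0 = (\<Sum>i<n. trace (u * \<alpha> ^ (i * j)) * d i)"
      using orth [of c] by (simp add: c_def)
    also have "\<dots> = (\<Sum>i<n. trace (d i * (u * \<alpha> ^ (i * j))))"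
      using dv by (intro sum.cong) (simp_all add: trace_mult_F3 vecs_def mult.commute)
    also have "\<dots> = trace (u * dft d j)"
      by (simp add: dft_def sum_distrib_left mult.left_commute flip: trace_sum)
    also have "\<dots> = trace y" using nz by (simp add: u_def)
    finally show False using y by simp
  qed
  with dv show "d \<in> zero_code ?Z'" by (simp add: zero_code_def)
qed

text \<open>Multiplication by 3 rotates digits and so keeps the weight. The exponent 0, which
  \<open>T_set\<close> omits, is never reached from a nonzero one.\<close>

lemma frob_closed_T_set: "frob_closed (T_set i1 i2 m)"
  unfolding frob_closed_def
proof (intro conjI ballI)
  show "T_set i1 i2 m \<subseteq> {..<n}"
    using T_set_subset [of i1 i2 m] by (auto simp: n_eq)
  fix j assume j: "j \<in> T_set i1 i2 m"
  then have jn: "0 < j" "j < n" using T_set_subset [of i1 i2 m] by (auto simp: n_eq)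
  have w: "w3 m (3 * j mod n) = w3 m j"
    using w3_rotate [of j m] jn by (simp add: n_eq)
  have "3 * j mod n \<noteq> 0"
  proof
    assume "3 * j mod n = 0"
    then have "(\<alpha> ^ j) ^ 3 = 1 ^ 3"
      by (simp add: mult.commute alpha_pow_eq_1_iff mod_eq_0_iff_dvd flip: power_mult)
    then have "\<alpha> ^ j = 1" by (simp only: cube_eq_iff)
    then show False using jn by (simp add: alpha_pow_eq_1_iff nat_dvd_not_less)
  qed
  moreover have "3 * j mod n < n" using n_pos by simp
  ultimately show "3 * j mod n \<in> T_set i1 i2 m"
    using j w by (simp add: T_set_def) (simp add: n_eq)
qed

lemma w3_reflect: "j \<le> n \<Longrightarrow> w3 m (n - j) + w3 m j = 2 * m"
  unfolding n_eq by (intro w3_complement order.strict_trans1 [of j "3 ^ m - 1" "3 ^ m"]) simp_all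

end

section \<open>The dual of the code for the residues 1 and 2\<close>

locale ternary_field_odd = ternary_field +
  fixes h N :: nat
  assumes m_eq: "m = 2 * h + 1" and h_pos: "0 < h" and n_eq_double: "n = N + N"
begin

lemma odd_m: "odd m" and m_ge_3: "3 \<le> m"
  using m_eq h_pos by simp_all

definition D :: "(nat \<Rightarrow> 'a) set" where
  "D = dual_code n (cyclic_code n (gen_poly \<alpha> 1 2 m))"

definition dual_zeros :: "nat set" where
  "dual_zeros = {j. j < n \<and> (n - j) mod n \<notin> T_set 1 2 m}"

text \<open>Multiplying by 3^(m - 1), the inverse of 3 modulo n, takes -3j back to -j. So if -3j
  were in the closed set \<open>T_set 1 2 m\<close>, then -j would be too.\<close>

lemma frob_closed_dual_zeros: "frob_closed dual_zeros"
  unfolding frob_closed_def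
proof (intro conjI ballI)
  fix j assume j: "j \<in> dual_zeros"
  show "3 * j mod n \<in> dual_zeros"
  proof (rule ccontr)
    assume "3 * j mod n \<notin> dual_zeros"
    then have "(n - 3 * j mod n) mod n \<in> T_set 1 2 m"
      using n_pos by (simp add: dual_zeros_def)
    then have "(n - 3 * j mod n) mod n * 3 ^ (m - 1) mod n \<in> T_set 1 2 m"
      by (rule frob_closed_mult_pow3 [OF frob_closed_T_set])
    also have "(n - 3 * j mod n) mod n * 3 ^ (m - 1) mod n = (n - j) mod n"
    proof -
      have "[3 * j * 3 ^ (m - 1) + (n - 3 * j mod n) * 3 ^ (m - 1) = 0] (mod n)"
      proof -
        have "[3 * j + (n - 3 * j mod n) = 3 * j mod n + (n - 3 * j mod n)] (mod n)"
          by (simp add: cong_def mod_add_left_eq)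
        also have "3 * j mod n + (n - 3 * j mod n) = n"
          using n_pos by simp
        finally have "[(3 * j + (n - 3 * j mod n)) * 3 ^ (m - 1) = n * 3 ^ (m - 1)] (mod n)"
          by (rule cong_scalar_right)
        also have "[n * 3 ^ (m - 1) = 0] (mod n)" by (simp add: cong_0_iff)
        finally show ?thesis by (simp only: distrib_right)
      qed
      moreover have "3 * j * 3 ^ (m - 1) = j * (n + 1)"
        using m_pos by (cases m) (simp_all add: n_eq)
      ultimately have "[n * j + (j + (n - 3 * j mod n) * 3 ^ (m - 1)) = 0] (mod n)"
        by (simp add: algebra_simps)
      then have "n dvd j + (n - 3 * j mod n) * 3 ^ (m - 1)"
        by (simp only: cong_0_iff dvd_add_right_iff dvd_triv_left)
      then have "[j + (n - 3 * j mod n) * 3 ^ (m - 1) = j + (n - j)] (mod n)"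
        using j by (simp add: cong_def mod_eq_0_iff_dvd dual_zeros_def)
      then have "[(n - 3 * j mod n) * 3 ^ (m - 1) = n - j] (mod n)"
        by (simp only: cong_add_lcancel_nat)
      then show ?thesis by (simp add: cong_def mod_mult_left_eq)
    qed
    finally show False using j by (simp add: dual_zeros_def)
  qed
qed (auto simp: dual_zeros_def)

lemma D_eq: "D = zero_code dual_zeros"
proof -
  have "gen_poly \<alpha> 1 2 m = gpoly (T_set 1 2 m)"
    by (simp add: gen_poly_def gpoly_def)
  then show ?thesis
    unfolding D_def dual_zeros_def
    by (simp only: cyclic_code_gpoly [OF frob_closed_T_set] dual_zero_code [OF frob_closed_T_set])
qed

text \<open>The complement of \<open>dual_zeros\<close> is the reflection of
  \<open>T_set 1 2 m\<close>, so the dimension is the size of that set; the 1 taken off is the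
  exponent 3^m - 1, which only \<open>w3_count\<close> counts.\<close>

lemma card_D: "card D = 3 ^ (w3_count m 0 - 1)"
proof -
  let ?T = "T_set 1 2 m"
  have T: "?T \<subseteq> {1..<n}" using T_set_subset [of 1 2 m] by (simp add: n_eq)
  have "{..<n} - dual_zeros = (\<lambda>j. n - j) ` ?T"
  proof (intro equalityI subsetI)
    fix j assume "j \<in> {..<n} - dual_zeros"
    then have j: "j < n" "(n - j) mod n \<in> ?T" by (auto simp: dual_zeros_def)
    then have "j \<noteq> 0" using T by (intro notI) auto
    with j show "j \<in> (\<lambda>j. n - j) ` ?T" by (intro image_eqI [of _ _ "n - j"]) simp_all
  next
    fix j assume "j \<in> (\<lambda>j. n - j) ` ?T"
    then obtain i where "j = n - i" "i \<in> ?T" by blast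
    then show "j \<in> {..<n} - dual_zeros" using T by (auto simp: dual_zeros_def)
  qed
  moreover have "inj_on (\<lambda>j. n - j) {1..<n}" by (auto simp: inj_on_def)
  then have "inj_on (\<lambda>j. n - j) ?T" using T by (rule inj_on_subset)
  ultimately have "card ({..<n} - dual_zeros) = card ?T" by (simp add: card_image)
  moreover have "dual_zeros \<subseteq> {..<n}" by (auto simp: dual_zeros_def)
  then have "card ({..<n} - dual_zeros) = n - card dual_zeros"
    by (simp add: card_Diff_subset finite_subset)
  moreover have "card ?T = w3_count m 0 - 1"
    using card_T_set_1_2 [OF odd_m] by simp
  ultimately show ?thesis
    by (simp add: D_eq card_zero_code [OF frob_closed_dual_zeros])
qed

lemma dft_D_0: "c \<in> D \<Longrightarrow> dft c 0 = 0"
  using n_pos by (simp add: D_eq zero_code_def dual_zeros_def T_set_def)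

text \<open>Negating an exponent takes weight w to 2m - w, which is 2 - w modulo 4 as m is odd.
  Weights 2 and 3 go to 0 and 3, outside the residues 1 and 2.\<close>

lemma dft_D:
  assumes c: "c \<in> D" and j: "0 < j" "j < n" and w: "w3 m j mod 4 \<in> {2, 3}"
  shows "dft c j = 0"
proof -
  have "w3 m (n - j) + w3 m j = 2 * m" using j by (simp add: w3_reflect)
  moreover have "2 * m mod 4 = 2" using odd_m by presburger
  ultimately have "(w3 m (n - j) + w3 m j) mod 4 = 2" by simp
  then have "(w3 m (n - j) mod 4 + w3 m j mod 4) mod 4 = 2" by (simp only: mod_add_eq)
  then have "w3 m (n - j) mod 4 \<notin> {1, 2}" using w by auto
  then have "j \<in> dual_zeros" using j by (simp add: dual_zeros_def T_set_def)
  with c show ?thesis by (simp add: D_eq zero_code_def)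
qed

section \<open>Folding a word into its even and odd parts\<close>

lemma alpha_pow_N: "\<alpha> ^ N = - 1"
proof -
  have "(\<alpha> ^ N)\<^sup>2 = 1"
    by (simp add: alpha_pow_eq_1_iff n_eq_double mult_2_right flip: power_mult)
  moreover have "\<alpha> ^ N \<noteq> 1"
    using n_pos n_eq_double by (simp add: alpha_pow_eq_1_iff nat_dvd_not_less)
  ultimately show ?thesis by (simp add: power2_eq_1_iff)
qed

lemma alpha_pow_shift_N: "\<alpha> ^ ((i + N) * j) = (- 1) ^ j * \<alpha> ^ (i * j)"
  by (simp only: distrib_right power_add power_mult [of \<alpha> N j] alpha_pow_N)
    (rule mult.commute)

text \<open>The second half enters with the sign (-1)^j because \<alpha>^N = -1.\<close>

lemma dft_even: "even j \<Longrightarrow> dft c j = (\<Sum>i<N. (c i + c (i + N)) * \<alpha> ^ (i * j))"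
  unfolding dft_def
  by (subst n_eq_double, subst sum_lessThan_double)
    (simp only: alpha_pow_shift_N, simp add: distrib_right)

lemma dft_odd: "odd j \<Longrightarrow> dft c j = (\<Sum>i<N. (c i - c (i + N)) * \<alpha> ^ (i * j))"
  unfolding dft_def
  by (subst n_eq_double, subst sum_lessThan_double)
    (simp only: alpha_pow_shift_N, simp add: left_diff_distrib)

text \<open>The number 2 is a combination of n and t = 3^r - 1: n = 3 (t + 2) t + 2 for r = h, and 3
  n + 2 = (t + 2) t for r = h + 1.\<close>

lemma n_dvd_mult_pow3_minus_1:
  assumes r: "r = h \<or> r = Suc h" and dvd: "n dvd d * (3 ^ r - 1)"
  shows "n dvd 2 * d"
proof -
  obtain t where t: "(3::nat) ^ r = t + 1"
    by (metis add.commute le_add_diff_inverse one_le_numeral one_le_power)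
  have td: "n dvd d * t" using dvd t by simp
  have m: "(3::nat) ^ m = 3 * (3 ^ h * 3 ^ h)"
    by (simp add: m_eq mult_2 power_add)
  from r show ?thesis
  proof
    assume "r = h"
    with m t have "3 ^ m = 3 * ((t + 1) * (t + 1))" by simp
    then have "n = 3 * (t + 2) * t + 2" by (simp add: n_eq algebra_simps)
    then have "d * n = 3 * (t + 2) * (d * t) + 2 * d" by (simp add: algebra_simps)
    then have "n dvd 3 * (t + 2) * (d * t) + 2 * d" by (metis dvd_triv_right)
    then show ?thesis using td by (simp only: dvd_add_right_iff dvd_mult)
  next
    assume "r = Suc h"
    with t have "3 * 3 ^ m = (t + 1) * (t + 1)"
      using m by (metis mult.assoc mult.left_commute power_Suc)
    moreover have "3 ^ m = n + 1" by (simp add: n_eq)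
    ultimately have "3 * n + 2 = (t + 2) * t" by (simp add: algebra_simps)
    then have "(3 * n + 2) * d = (t + 2) * t * d" by simp
    then have "(3 * d) * n + 2 * d = (t + 2) * (d * t)" by (simp add: algebra_simps)
    then have "n dvd (3 * d) * n + 2 * d" using td by simp
    then show ?thesis by (simp only: dvd_add_right_iff dvd_triv_right)
  qed
qed

text \<open>A coincidence would make n divide 2 (j - i), a positive number below n = 2N.\<close>

lemma inj_on_alpha_pow3_minus_1:
  assumes "r = h \<or> r = Suc h"
  shows "inj_on (\<lambda>i. \<alpha> ^ (i * (3 ^ r - 1))) {..<N}"
proof (rule linorder_inj_onI')
  fix i j assume ij: "i \<in> {..<N}" "j \<in> {..<N}" "i < j"
  define u :: nat where "u = 3 ^ r - 1"
  show "\<alpha> ^ (i * (3 ^ r - 1)) \<noteq> \<alpha> ^ (j * (3 ^ r - 1))"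
    unfolding u_def [symmetric]
  proof
    assume "\<alpha> ^ (i * u) = \<alpha> ^ (j * u)"
    also have "j * u = i * u + (j - i) * u"
      using ij by (simp flip: distrib_right)
    finally have "\<alpha> ^ ((j - i) * u) = 1"
      using alpha_nz by (simp add: power_add)
    then have "n dvd 2 * (j - i)"
      using n_dvd_mult_pow3_minus_1 [OF assms] by (simp add: alpha_pow_eq_1_iff u_def)
    moreover have "0 < 2 * (j - i)" "2 * (j - i) < n"
      using ij n_eq_double by auto
    ultimately show False using nat_dvd_not_less by blast
  qed
qed

text \<open>Every multiple of 3^r - 1 is even, so the transform there sees only the even part. The
  factors k from 0 to 3^h give 3^h + 1 successive zeros.\<close>

lemma even_part_weight:
  assumes c: "c \<in> D" and nz: "\<exists>i<N. c i + c (i + N) \<noteq> 0"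
    and r: "r = h \<or> r = Suc h" "odd r"
  shows "3 ^ h + 1 < card {i. i < N \<and> c i + c (i + N) \<noteq> 0}"
proof (rule bch_bound [OF inj_on_alpha_pow3_minus_1 [OF r(1)] _ nz])
  fix k :: nat assume k: "k < 3 ^ h + 1"
  have "dft c (k * (3 ^ r - 1)) = 0"
  proof (cases "k = 0")
    case False
    let ?j = "k * (3 ^ r - 1)"
    have w: "w3 m ?j = 2 * r" and less: "?j < 3 ^ (r + h)"
      using w3_mult_pow3_minus_1 [of k h r m] False k r m_eq by auto
    have "r + h \<le> m" using r m_eq by auto
    then have "(3::nat) ^ (r + h) \<le> 3 ^ m" by (simp add: power_increasing)
    with less have "?j < 3 ^ m" by (rule order.strict_trans2)
    then have "?j \<le> n" by (simp add: n_eq)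
    \<comment> \<open>The exponent n has weight 2m, more than 2r.\<close>
    moreover have "?j \<noteq> n"
    proof
      assume "?j = n"
      then have "w3 m ?j = 2 * m" using w3_reflect [of 0] by simp
      with w r m_eq h_pos show False by auto
    qed
    moreover have "0 < ?j"
    proof (rule ccontr)
      assume "\<not> 0 < ?j"
      then have "?j = 0" by (simp only: not_gr_zero)
      then have "w3 m ?j = 0" by (simp only: w3_zero)
      with w r show False by auto
    qed
    moreover have "2 * r mod 4 = 2" using r(2) by presburger
    ultimately show ?thesis using dft_D [OF c, of ?j] w by simp
  qed (simp add: dft_D_0 [OF c])
  then show "(\<Sum>i<N. (c i + c (i + N)) * (\<alpha> ^ (i * (3 ^ r - 1))) ^ k) = 0"
    using dft_even [of "k * (3 ^ r - 1)" c] by (simp add: ac_simps flip: power_mult)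
qed

text \<open>The summand 3^(2h) puts a digit 1 above the 2h places available to i (3^r - 1), which
  makes the exponent odd and its weight 2r + 1. The progression starts at \<open>?b\<close>; the
  corresponding powers of \<alpha> are absorbed into the coefficients and leave the support
  unchanged.\<close>

lemma odd_part_weight:
  assumes c: "c \<in> D" and nz: "\<exists>i<N. c i - c (i + N) \<noteq> 0"
    and r: "r = h \<or> r = Suc h" "odd r"
  shows "3 ^ (2 * h - r) < card {i. i < N \<and> c i - c (i + N) \<noteq> 0}"
proof -
  let ?u = "3 ^ r - 1 :: nat" and ?b = "3 ^ (2 * h) + (3 ^ r - 1) :: nat"
  let ?f = "\<lambda>i. (c i - c (i + N)) * \<alpha> ^ (i * ?b)"
  have rh: "r \<le> 2 * h" using r h_pos by auto
  have "3 ^ (2 * h - r) < card {i. i < N \<and> ?f i \<noteq> 0}"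
  proof (rule bch_bound [OF inj_on_alpha_pow3_minus_1 [OF r(1)]])
    show "\<exists>i<N. ?f i \<noteq> 0" using nz alpha_nz by simp
    fix k :: nat assume k: "k < 3 ^ (2 * h - r)"
    \<comment> \<open>Counting starts at 1, since the multiple 0 would leave the exponent 3^(2h) of
      weight 1.\<close>
    let ?x = "(k + 1) * ?u"
    let ?j = "3 ^ (2 * h) + ?x"
    have w: "w3 (2 * h) ?x = 2 * r" and less: "?x < 3 ^ (r + (2 * h - r))"
      using w3_mult_pow3_minus_1 [of "k + 1" "2 * h - r" r "2 * h"] k r rh by auto
    then have less: "?x < 3 ^ (2 * h)" using rh by simp
    have "w3 m ?j = 2 * r + 1"
      using w3_add_leading_one [OF less] w by (simp add: m_eq)
    moreover have "(2 * r + 1) mod 4 = 3" using r(2) by presburger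
    moreover have "0 < ?j" by simp
    moreover have "?j < n"
    proof -
      have "(1::nat) \<le> 3 ^ (2 * h)" by simp
      moreover have "n = 3 * 3 ^ (2 * h) - 1" by (simp add: n_eq m_eq)
      ultimately show ?thesis using less by linarith
    qed
    ultimately have "dft c ?j = 0" using dft_D [OF c, of ?j] by simp
    moreover have "odd ?j" by simp
    moreover have "?j = ?b + k * ?u" by (simp only: distrib_right mult_1 ac_simps)
    ultimately show "(\<Sum>i<N. ?f i * (\<alpha> ^ (i * ?u)) ^ k) = 0"
      using dft_odd [of ?j c]
      by (simp only:) (simp add: distrib_left power_add mult.assoc mult.commute [of k] flip: power_mult)
  qed
  moreover have "?f i \<noteq> 0 \<longleftrightarrow> c i - c (i + N) \<noteq> 0" for i
    using alpha_nz by simp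
  ultimately show ?thesis by (simp only:)
qed

section \<open>Self-orthogonality of the even part and the minimum distance\<close>

lemma vecs_D: "c \<in> D \<Longrightarrow> c \<in> vecs n"
  by (simp add: D_def dual_code_def)

text \<open>For j > 0 the weights of j and n - j are even and add up to 2 modulo 4, so one of them
  is 2 modulo 4 and the transform vanishes there.\<close>

lemma dft_even_orthogonal:
  assumes c: "c \<in> D" and j: "even j" "j < n"
  shows "dft c j * dft c (n - j) = 0"
proof (cases "j = 0")
  case False
  have w: "even (w3 m j)" using even_w3_iff [of j m] j by (simp add: n_eq)
  have "w3 m (n - j) + w3 m j = 2 * m" using j by (simp add: w3_reflect)
  moreover have "2 * m mod 4 = 2" using odd_m by presburger
  ultimately have "(w3 m (n - j) mod 4 + w3 m j mod 4) mod 4 = 2" by (simp only: mod_add_eq)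
  moreover have "w3 m j mod 4 = 0 \<or> w3 m j mod 4 = 2" using w by presburger
  ultimately have "w3 m j mod 4 = 2 \<or> w3 m (n - j) mod 4 = 2" by auto
  then show ?thesis
    using dft_D [OF c, of j] dft_D [OF c, of "n - j"] False j by auto
qed (simp add: dft_D_0 [OF c])

text \<open>Negating an even exponent exchanges the weights 2 and 0 modulo 4, so by Parseval the even part
  is self-orthogonal; nonzero elements of the prime field have square 1.\<close>

lemma three_dvd_even_part_weight:
  assumes c: "c \<in> D"
  shows "3 dvd card {i. i < N \<and> c i + c (i + N) \<noteq> 0}"
proof -
  define s where "s i = c i + c (i + N)" for i
  \<comment> \<open>The even part repeated on both halves, so that Parseval at length n applies: its
    transform vanishes at odd exponents and is twice that of c at even ones.\<close>
  define S where "S i = (if i < N then s i else s (i - N))" for i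
  have S: "S i = s i" "S (i + N) = s i" if "i < N" for i
    using that by (simp_all add: S_def)
  have odd: "dft S j = 0" if "odd j" for j
    using that by (simp add: dft_odd S)
  have even: "dft S j = 2 * dft c j" if "even j" for j
    using that by (simp add: dft_even S s_def [symmetric] mult.assoc flip: mult_2 sum_distrib_left)
  have "dft S j * dft S (n - j) = 0" if "j < n" for j
  proof (cases "even j")
    case True
    moreover from this that have "even (n - j)" by (simp add: n_eq_double)
    ultimately show ?thesis using dft_even_orthogonal [OF c, of j] that by (simp add: even)
  qed (simp add: odd)
  then have "(\<Sum>j<n. dft S j * dft S (n - j)) = 0"
    by (intro sum.neutral) simp
  then have "(\<Sum>i<n. S i * S i) = 0"
    using parseval [of S S] by simp
  then have "(\<Sum>i<N. S i * S i + S (i + N) * S (i + N)) = 0"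
    by (simp only: n_eq_double sum_lessThan_double)
  then have "2 * (\<Sum>i<N. (s i)\<^sup>2) = 0"
    by (simp add: S power2_eq_square flip: mult_2 sum_distrib_left)
  moreover have "(s i)\<^sup>2 = (if s i \<noteq> 0 then 1 else 0)" if "i < N" for i
  proof -
    have "c i \<in> F3" "c (i + N) \<in> F3"
      using vecs_D [OF c] that n_eq_double by (simp_all add: vecs_def)
    then show ?thesis by (simp add: s_def F3_square add_F3)
  qed
  ultimately have "(\<Sum>i<N. if s i \<noteq> 0 then 1 else 0 :: 'a) = 0"
    using two_eq_minus_1 by simp
  then have "of_nat (card {i. i < N \<and> s i \<noteq> 0}) = (0::'a)"
    by (simp flip: sum.inter_filter)
  then show ?thesis by (simp only: of_nat_eq_0_iff s_def)
qed

lemma hweight_eq: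
  "hweight n c = card {i. i < N \<and> c i \<noteq> 0} + card {i. i < N \<and> c (i + N) \<noteq> 0}"
  unfolding hweight_def by (simp only: n_eq_double card_Collect_less_double)

text \<open>The weight of the even part is at most that of c. If the even part vanishes, the halves
  are negatives of each other and the odd part is 2c = -c on the first half, so each half has its
  weight.\<close>

lemma hweight_bound:
  assumes c: "c \<in> D" "c \<noteq> (\<lambda>_. 0)"
  shows "3 ^ h + (if odd h then 9 else 7) \<le> 2 * hweight n c"
proof (cases "\<exists>i<N. c i + c (i + N) \<noteq> 0")
  case True
  let ?S = "{i. i < N \<and> c i + c (i + N) \<noteq> 0}"
  obtain r where "r = h \<or> r = Suc h" "odd r"
    using that [of h] that [of "Suc h"] by (cases "odd h") auto
  with even_part_weight [OF c(1) True] have "3 ^ h + 1 < card ?S" by blast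
  moreover obtain k where k: "card ?S = 3 * k"
    using three_dvd_even_part_weight [OF c(1)] by (elim dvdE)
  moreover obtain q where q: "3 ^ h = 3 * q" "0 < (q::nat)" using h_pos by (cases h) auto
  \<comment> \<open>A multiple of 3 above 3^h + 1 is at least 3^h + 3, as 3 divides 3^h.\<close>
  ultimately have "q < k" by linarith
  then have "3 ^ h + 3 \<le> card ?S" using k q by linarith
  also have "card ?S \<le> card ({i. i < N \<and> c i \<noteq> 0} \<union> {i. i < N \<and> c (i + N) \<noteq> 0})"
    by (intro card_mono) auto
  also have "\<dots> \<le> hweight n c"
    unfolding hweight_eq by (rule card_Un_le)
  finally show ?thesis using q by simp
next
  case False
  then have neg: "c (i + N) = - c i" if "i < N" for i
    using that by (simp add: add_eq_0_iff)
  have diff: "c i - c (i + N) \<noteq> 0 \<longleftrightarrow> c i \<noteq> 0" if "i < N" for i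
  proof -
    have "c i - c (i + N) = - c i"
      using neg [OF that] two_eq_minus_1 by (simp flip: mult_2)
    then show ?thesis by (simp only: neg_equal_0_iff_equal)
  qed
  obtain i where i: "c i \<noteq> 0" using c(2) by auto
  then have "i < N + N"
    using vecs_D [OF c(1)] by (auto simp: vecs_def n_eq_double not_less [symmetric])
  have "\<exists>i<N. c i \<noteq> 0"
  proof (cases "i < N")
    case False
    with \<open>i < N + N\<close> have "i - N < N" "i - N + N = i" by linarith+
    with neg [of "i - N"] i have "c (i - N) \<noteq> 0" by auto
    with \<open>i - N < N\<close> show ?thesis by blast
  qed (use i in blast)
  then have nz: "\<exists>i<N. c i - c (i + N) \<noteq> 0"
    using diff by blast
  have "{i. i < N \<and> c i - c (i + N) \<noteq> 0} = {i. i < N \<and> c i \<noteq> 0}"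
    using diff by blast
  moreover have "{i. i < N \<and> c (i + N) \<noteq> 0} = {i. i < N \<and> c i \<noteq> 0}"
    using neg by auto
  ultimately have hw: "hweight n c = 2 * card {i. i < N \<and> c i - c (i + N) \<noteq> 0}"
    by (simp add: hweight_eq)
  show ?thesis
  proof (cases "odd h")
    case True
    then have "3 ^ h < card {i. i < N \<and> c i - c (i + N) \<noteq> 0}"
      using odd_part_weight [OF c(1) nz, of h] by simp
    moreover have "(3::nat) \<le> 3 ^ h" using h_pos by (cases h) auto
    ultimately show ?thesis using hw True by simp
  next
    case False
    \<comment> \<open>Here r = h + 1 and 2h - r = h - 1 = l + 1. The final estimate is 4 (3^(h - 1)
      + 1) = 3^h + 3^(h - 1) + 4 \<ge> 3^h + 7.\<close>
    then obtain l where l: "h = Suc (Suc l)"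
      using h_pos by (cases h; cases "h - 1") auto
    then have "3 ^ Suc l < card {i. i < N \<and> c i - c (i + N) \<noteq> 0}"
      using odd_part_weight [OF c(1) nz, of "Suc h"] False by simp
    moreover have "(3::nat) ^ h = 3 * 3 ^ Suc l" "(3::nat) \<le> 3 ^ Suc l" using l by simp_all
    ultimately have "3 ^ h + 7 \<le> 2 * hweight n c" unfolding hw by linarith
    then show ?thesis using False by simp
  qed
qed

text \<open>As \<open>min_dist\<close> is a \<open>Min\<close>, a nonzero codeword has to exist: the
  dimension is positive because \<open>w3_count m 0\<close> exceeds 1.\<close>

lemma min_dist_bound: "3 ^ h + (if odd h then 9 else 7) \<le> 2 * min_dist n D"
proof -
  have fin: "finite (hweight n ` (D - {\<lambda>_. 0}))"
  proof (rule finite_subset)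
    have "hweight n c \<le> n" for c :: "nat \<Rightarrow> 'a"
      unfolding hweight_def using card_mono [of "{..<n}" "{i. i < n \<and> c i \<noteq> 0}"] by auto
    then show "hweight n ` (D - {\<lambda>_. 0}) \<subseteq> {..n}" by auto
  qed simp
  have "1 < w3_count m 0"
    using w3_count_odd [OF odd_m] power_increasing [OF m_ge_3, of "3::nat"]
    by (simp split: if_splits)
  then have "1 < card D"
    unfolding card_D by (intro one_less_power) simp_all
  then have "D - {\<lambda>_. 0} \<noteq> {}"
    using card_mono [of "{\<lambda>_. 0 :: 'a}" D] by (intro notI) simp
  then have "min_dist n D \<in> hweight n ` (D - {\<lambda>_. 0})"
    unfolding min_dist_def using fin by (intro Min_in) auto
  then show ?thesis using hweight_bound by auto
qed

end

theorem theorem8: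
  fixes \<alpha> :: "'a::{finite,field}" and m n :: nat
  assumes "CARD('a) = 3 ^ m"
    and "\<forall>x::'a. x \<noteq> 0 \<longrightarrow> (\<exists>j. x = \<alpha> ^ j)"
    and "m \<ge> 3" and "odd m"
    and "n = 3 ^ m - 1"
  shows "let D = dual_code n (cyclic_code n (gen_poly \<alpha> 1 2 m)) in
     (m mod 4 = 3 \<longrightarrow>
        real (min_dist n D) \<ge> (3 ^ ((m - 1) div 2) + 9) / 2 \<and> dim3 D ((n - 2) div 2)) \<and>
     (m mod 4 = 1 \<longrightarrow>
        real (min_dist n D) \<ge> (3 ^ ((m - 1) div 2) + 7) / 2 \<and> dim3 D (n div 2))"
proof -
  define h where "h = (m - 1) div 2"
  interpret ternary_field_odd \<alpha> m n h "n div 2"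
  proof unfold_locales
    show "m = 2 * h + 1" "0 < h"
      using assms(3,4) by (auto simp: h_def elim!: oddE)
    have "even n" by (simp add: assms(5))
    then show "n = n div 2 + n div 2" by (auto elim!: evenE)
  qed (use assms in auto)
  have "real (3 ^ h + (if odd h then 9 else 7)) \<le> real (2 * min_dist n D)"
    using min_dist_bound by (rule of_nat_mono)
  moreover have "m mod 4 = 3 \<Longrightarrow> odd h" "m mod 4 = 1 \<Longrightarrow> even h"
    using m_eq by presburger+
  ultimately have d: "m mod 4 = 3 \<Longrightarrow> (3 ^ h + 9) / 2 \<le> real (min_dist n D)"
    "m mod 4 = 1 \<Longrightarrow> (3 ^ h + 7) / 2 \<le> real (min_dist n D)"
    by (auto simp: field_simps)
  \<comment> \<open>The residue of m decides whether \<open>w3_count m 0\<close> is n / 2 or n / 2 +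
    1; one less is the dimension.\<close>
  have "2 * w3_count m 0 + (if m mod 4 = 3 then 1 else 0) = n + 1 + (if m mod 4 = 1 then 1 else 0)"
    using w3_count_odd [OF odd_m] by (simp add: n_eq)
  then have "m mod 4 = 3 \<Longrightarrow> w3_count m 0 - 1 = (n - 2) div 2"
    "m mod 4 = 1 \<Longrightarrow> w3_count m 0 - 1 = n div 2"
    by auto
  then show ?thesis
    using d card_D unfolding Let_def D_def [symmetric] h_def [symmetric] dim3_def by auto
qed

end
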